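(* For any $\Gamma\cup\{\varphi\}\subseteq Fm_{\mathcal L}$: $\Gamma\vdash_{\mathbf{GV}}\varphi\Leftrightarrow\Gamma\models_{\mathsf{LTS},g}\varphi$.
   Context: $\mathcal L$ is the language $\{\land,\lor,\to,0,1\}$ expanded with a binary counterfactual connective $\mathbin{\Box\!\!\rightarrow}$. $\mathbf{GV}$ is the smallest finitary consequence relation containing classical axioms and (L1) $\varphi\mathbin{\Box\!\!\rightarrow}\varphi$, (L2) $((\varphi\mathbin{\Box\!\!\rightarrow}\psi)\wedge(\psi\mathbin{\Box\!\!\rightarrow}\varphi))\to((\varphi\mathbin{\Box\!\!\rightarrow}\gamma)\leftrightarrow(\psi\mathbin{\Box\!\!\rightarrow}\gamma))$, (L3) $((\varphi\vee\psi)\mathbin{\Box\!\!\rightarrow}\varphi)\vee((\varphi\vee\psi)\mathbin{\Box\!\!\rightarrow}\psi)\vee(((\varphi\vee\psi)\mathbin{\Box\!\!\rightarrow}\gamma)\leftrightarrow((\varphi\mathbin{\Box\!\!\rightarrow}\gamma)\wedge(\psi\mathbin{\Box\!\!\rightarrow}\gamma)))$, (L4) $(\varphi\mathbin{\Box\!\!\rightarrow}(\psi\land\gamma))\leftrightarrow((\varphi\mathbin{\Box\!\!\rightarrow}\psi)\land(\varphi\mathbin{\Box\!\!\rightarrow}\gamma))$, closed under modus ponens and (C) $\varphi\to\psi\vdash(\gamma\mathbin{\Box\!\!\rightarrow}\varphi)\to(\gamma\mathbin{\Box\!\!\rightarrow}\psi)$. A topological sphere is $(S,\tau,\sigma)$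 with $(S,\tau)$ a Stone space and $\sigma(x)$ a nested family of subsets of $S$ for each $x$, such that for clopens $A,B$: $\{x:A\cap\bigcap\{U\in\sigma(x):U\cap A\neq\emptyset\}\subseteq B\}$ is clopen; if $A\cap\bigcup\sigma(x)\neq\emptyset$ there is a smallest $U\in\sigma(x)$ meeting $A$ (limit assumption); and $A\cap\bigcap\{U\in\sigma(x):U\cap A\neq\emptyset\}$ is closed. $\mathsf{LTS}$ (Lewis topological spheres) is the class of sphere models $(S,\sigma,v)$ obtained from a topological sphere with $v$ assigning variables to clopen subsets of $S$, where sphere-model satisfaction is: Boolean connectives classically and $v(\varphi\mathbin{\Box\!\!\rightarrow}\psi)=\{w:\bigcup\sigma(w)\cap v(\varphi)=\emptyset$ or $\exists U\in\sigma(w)$ with $\emptyset\neq U\cap v(\varphi)\subseteq v(\psi)\}$. $\Gamma\models_{\mathsf{LTS},g}\varphi$ iff for every model in $\mathsf{LTS}$, if every world satisfies all of $\Gamma$ then every world satisfies $\varphi$. *)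

theory Defs
  imports "HOL-Analysis.Analysis"
begin

datatype 'v fm =
    Var 'v
  | Bot
  | Top
  | Conj "'v fm" "'v fm"  (infixr \<open>\<^bold>\<and>\<close> 70)
  | Disj "'v fm" "'v fm"  (infixr \<open>\<^bold>\<or>\<close> 65)
  | Impl "'v fm" "'v fm"  (infixr \<open>\<^bold>\<rightarrow>\<close> 55)
  | Cf "'v fm" "'v fm"    (infix \<open>\<box>\<rightarrow>\<close> 60)

abbreviation Iff :: "'v fm \<Rightarrow> 'v fm \<Rightarrow> 'v fm"  (infix \<open>\<^bold>\<leftrightarrow>\<close> 52) where
  "p \<^bold>\<leftrightarrow> q \<equiv> (p \<^bold>\<rightarrow> q) \<^bold>\<and> (q \<^bold>\<rightarrow> p)"

text \<open>A Hilbert axiomatisation of classical propositional logic, with negation of \<open>p\<close>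
  read as \<open>p \<^bold>\<rightarrow> Bot\<close>.\<close>

inductive_set classical_axioms :: "'v fm set" where
  K:     "p \<^bold>\<rightarrow> (q \<^bold>\<rightarrow> p) \<in> classical_axioms"
| S:     "(p \<^bold>\<rightarrow> (q \<^bold>\<rightarrow> r)) \<^bold>\<rightarrow> ((p \<^bold>\<rightarrow> q) \<^bold>\<rightarrow> (p \<^bold>\<rightarrow> r)) \<in> classical_axioms"
| ConjE1: "(p \<^bold>\<and> q) \<^bold>\<rightarrow> p \<in> classical_axioms"
| ConjE2: "(p \<^bold>\<and> q) \<^bold>\<rightarrow> q \<in> classical_axioms"
| ConjI: "p \<^bold>\<rightarrow> (q \<^bold>\<rightarrow> (p \<^bold>\<and> q)) \<in> classical_axioms"
| DisjI1: "p \<^bold>\<rightarrow> (p \<^bold>\<or> q) \<in> classical_axioms"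
| DisjI2: "q \<^bold>\<rightarrow> (p \<^bold>\<or> q) \<in> classical_axioms"
| DisjE: "(p \<^bold>\<rightarrow> r) \<^bold>\<rightarrow> ((q \<^bold>\<rightarrow> r) \<^bold>\<rightarrow> ((p \<^bold>\<or> q) \<^bold>\<rightarrow> r)) \<in> classical_axioms"
| BotE:  "Bot \<^bold>\<rightarrow> p \<in> classical_axioms"
| TopI:  "Top \<in> classical_axioms"
| DN:    "((p \<^bold>\<rightarrow> Bot) \<^bold>\<rightarrow> Bot) \<^bold>\<rightarrow> p \<in> classical_axioms"

inductive_set lewis_axioms :: "'v fm set" where
  L1: "p \<box>\<rightarrow> p \<in> lewis_axioms"
| L2: "((p \<box>\<rightarrow> q) \<^bold>\<and> (q \<box>\<rightarrow> p)) \<^bold>\<rightarrow> ((p \<box>\<rightarrow> r) \<^bold>\<leftrightarrow> (q \<box>\<rightarrow> r)) \<in> lewis_axioms"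
| L3: "((p \<^bold>\<or> q) \<box>\<rightarrow> p) \<^bold>\<or> ((p \<^bold>\<or> q) \<box>\<rightarrow> q) \<^bold>\<or>
       (((p \<^bold>\<or> q) \<box>\<rightarrow> r) \<^bold>\<leftrightarrow> ((p \<box>\<rightarrow> r) \<^bold>\<and> (q \<box>\<rightarrow> r))) \<in> lewis_axioms"
| L4: "(p \<box>\<rightarrow> (q \<^bold>\<and> r)) \<^bold>\<leftrightarrow> ((p \<box>\<rightarrow> q) \<^bold>\<and> (p \<box>\<rightarrow> r)) \<in> lewis_axioms"

text \<open>Rule \<open>C\<close> applies to anything derivable from \<open>G\<close>, not only to theorems:
  \<open>GV\<close> is the global consequence relation.\<close>

inductive GV :: "'v fm set \<Rightarrow> 'v fm \<Rightarrow> bool"  (infix \<open>\<turnstile>\<^sub>G\<^sub>V\<close> 40)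
  for G :: "'v fm set" where
  Asm: "p \<in> G \<Longrightarrow> G \<turnstile>\<^sub>G\<^sub>V p"
| Cl:  "p \<in> classical_axioms \<Longrightarrow> G \<turnstile>\<^sub>G\<^sub>V p"
| Lw:  "p \<in> lewis_axioms \<Longrightarrow> G \<turnstile>\<^sub>G\<^sub>V p"
| MP:  "G \<turnstile>\<^sub>G\<^sub>V p \<^bold>\<rightarrow> q \<Longrightarrow> G \<turnstile>\<^sub>G\<^sub>V p \<Longrightarrow> G \<turnstile>\<^sub>G\<^sub>V q"
| C:   "G \<turnstile>\<^sub>G\<^sub>V p \<^bold>\<rightarrow> q \<Longrightarrow> G \<turnstile>\<^sub>G\<^sub>V (r \<box>\<rightarrow> p) \<^bold>\<rightarrow> (r \<box>\<rightarrow> q)"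

text \<open>\<open>GV\<close> is the smallest finitary consequence relation that contains the axioms and
  is closed under the two rules.\<close>

definition finitary_consequence :: "('v fm set \<Rightarrow> 'v fm \<Rightarrow> bool) \<Rightarrow> bool" where
  "finitary_consequence R \<longleftrightarrow>
     (\<forall>G p. p \<in> G \<longrightarrow> R G p) \<and>
     (\<forall>G D p. (\<forall>q\<in>D. R G q) \<longrightarrow> R D p \<longrightarrow> R G p) \<and>
     (\<forall>G p. R G p \<longrightarrow> (\<exists>F. finite F \<and> F \<subseteq> G \<and> R F p))"

definition GV_closed :: "('v fm set \<Rightarrow> 'v fm \<Rightarrow> bool) \<Rightarrow> bool" where
  "GV_closed R \<longleftrightarrow>
     (\<forall>p \<in> classical_axioms \<union> lewis_axioms. R {} p) \<and>
     (\<forall>p q. R {p, p \<^bold>\<rightarrow> q} q) \<and>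
     (\<forall>p q r. R {p \<^bold>\<rightarrow> q} ((r \<box>\<rightarrow> p) \<^bold>\<rightarrow> (r \<box>\<rightarrow> q)))"

lemma GV_cut:
  assumes "D \<turnstile>\<^sub>G\<^sub>V p" "\<forall>q\<in>D. G \<turnstile>\<^sub>G\<^sub>V q"
  shows "G \<turnstile>\<^sub>G\<^sub>V p"
  using assms by (induction rule: GV.induct) (auto intro: GV.intros)

lemma GV_finite: "G \<turnstile>\<^sub>G\<^sub>V p \<Longrightarrow> \<exists>F. finite F \<and> F \<subseteq> G \<and> F \<turnstile>\<^sub>G\<^sub>V p"
proof (induction rule: GV.induct)
  case (Asm p)
  then show ?case by (intro exI[of _ "{p}"]) (auto intro: GV.Asm)
next
  case (Cl p)
  then show ?case by (intro exI[of _ "{}"]) (auto intro: GV.Cl)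
next
  case (Lw p)
  then show ?case by (intro exI[of _ "{}"]) (auto intro: GV.Lw)
next
  case (MP p q)
  then obtain E F where
    "finite E" "E \<subseteq> G" "E \<turnstile>\<^sub>G\<^sub>V p \<^bold>\<rightarrow> q" "finite F" "F \<subseteq> G" "F \<turnstile>\<^sub>G\<^sub>V p" by blast
  moreover from this have "E \<union> F \<turnstile>\<^sub>G\<^sub>V p \<^bold>\<rightarrow> q" "E \<union> F \<turnstile>\<^sub>G\<^sub>V p"
    by (meson GV_cut GV.Asm UnI1 UnI2)+
  ultimately show ?case by (intro exI[of _ "E \<union> F"]) (auto intro: GV.MP)
next
  case (C p q r)
  then show ?case by (blast intro: GV.C)
qed

theorem GV_smallest:
  fixes R :: "'a fm set \<Rightarrow> 'a fm \<Rightarrow> bool"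
  shows "finitary_consequence (GV :: 'a fm set \<Rightarrow> _)" and "GV_closed (GV :: 'a fm set \<Rightarrow> _)"
    and "finitary_consequence R \<Longrightarrow> GV_closed R \<Longrightarrow> G \<turnstile>\<^sub>G\<^sub>V p \<Longrightarrow> R G p"
proof -
  show "finitary_consequence (GV :: 'a fm set \<Rightarrow> _)"
    unfolding finitary_consequence_def by (meson GV.Asm GV_cut GV_finite)
  have "{p, p \<^bold>\<rightarrow> q} \<turnstile>\<^sub>G\<^sub>V q" for p q :: "'a fm"
    by (rule GV.MP[of _ p]) (auto intro: GV.Asm)
  then show "GV_closed (GV :: 'a fm set \<Rightarrow> _)"
    unfolding GV_closed_def by (auto intro: GV.Asm GV.Cl GV.Lw GV.C)
  assume fin: "finitary_consequence R" and closed: "GV_closed R"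
  have cut: "R G p" if "R D p" "\<forall>q\<in>D. R G q" for G D p
    using that fin unfolding finitary_consequence_def by blast
  show "R G p" if "G \<turnstile>\<^sub>G\<^sub>V p"
    using that
  proof (induction rule: GV.induct)
    case (Asm p)
    then show ?case using fin unfolding finitary_consequence_def by blast
  next
    case (Cl p)
    then show ?case using closed cut[of "{}"] unfolding GV_closed_def by blast
  next
    case (Lw p)
    then show ?case using closed cut[of "{}"] unfolding GV_closed_def by blast
  next
    case (MP p q)
    then show ?case using closed cut[of "{p, p \<^bold>\<rightarrow> q}"] unfolding GV_closed_def by blast
  next
    case (C p q r)
    then show ?case using closed cut[of "{p \<^bold>\<rightarrow> q}"] unfolding GV_closed_def by blast
  qed
qed

definition Stone_space :: "'w topology \<Rightarrow> bool" where
  "Stone_space X \<longleftrightarrow> compact_space X \<and> Hausdorff_space X \<and>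
     (\<forall>D. connectedin X D \<longrightarrow> (\<forall>x\<in>D. \<forall>y\<in>D. x = y))"

definition clopenin :: "'w topology \<Rightarrow> 'w set \<Rightarrow> bool" where
  "clopenin X A \<longleftrightarrow> openin X A \<and> closedin X A"

text \<open>The set \<open>A \<inter> \<Inter>{U \<in> \<sigma> x. U \<inter> A \<noteq> {}}\<close> of the \<open>A\<close>-worlds closest to \<open>x\<close>, where the
  intersection of the empty family is read as the empty set, in accordance with the vacuous
  case of the satisfaction clause: no world is closest if no sphere around \<open>x\<close> meets \<open>A\<close>.
  (The library has \<open>\<Inter>{} = UNIV\<close>, hence the case distinction.)\<close>

definition closest :: "('w \<Rightarrow> 'w set set) \<Rightarrow> 'w set \<Rightarrow> 'w \<Rightarrow> 'w set" where
  "closest \<sigma> A x =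
     (if A \<inter> \<Union>(\<sigma> x) = {} then {} else A \<inter> \<Inter>{U \<in> \<sigma> x. U \<inter> A \<noteq> {}})"

definition topological_sphere :: "'w topology \<Rightarrow> ('w \<Rightarrow> 'w set set) \<Rightarrow> bool" where
  "topological_sphere X \<sigma> \<longleftrightarrow>
     Stone_space X \<and>
     (\<forall>x \<in> topspace X. (\<forall>U \<in> \<sigma> x. U \<subseteq> topspace X) \<and> chain\<^sub>\<subseteq> (\<sigma> x)) \<and>
     (\<forall>A B. clopenin X A \<longrightarrow> clopenin X B \<longrightarrow>
        clopenin X {x \<in> topspace X. closest \<sigma> A x \<subseteq> B}) \<and>
     (\<forall>A. clopenin X A \<longrightarrow> (\<forall>x \<in> topspace X.
        (A \<inter> \<Union>(\<sigma> x) \<noteq> {} \<longrightarrow>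
           (\<exists>U \<in> \<sigma> x. U \<inter> A \<noteq> {} \<and> (\<forall>V \<in> \<sigma> x. V \<inter> A \<noteq> {} \<longrightarrow> U \<subseteq> V))) \<and>
        closedin X (closest \<sigma> A x)))"

primrec truth :: "'w set \<Rightarrow> ('w \<Rightarrow> 'w set set) \<Rightarrow> ('v \<Rightarrow> 'w set) \<Rightarrow> 'v fm \<Rightarrow> 'w set" where
  "truth S \<sigma> v (Var a) = v a"
| "truth S \<sigma> v Bot = {}"
| "truth S \<sigma> v Top = S"
| "truth S \<sigma> v (p \<^bold>\<and> q) = truth S \<sigma> v p \<inter> truth S \<sigma> v q"
| "truth S \<sigma> v (p \<^bold>\<or> q) = truth S \<sigma> v p \<union> truth S \<sigma> v q"
| "truth S \<sigma> v (p \<^bold>\<rightarrow> q) = (S - truth S \<sigma> v p) \<union> truth S \<sigma> v q"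
| "truth S \<sigma> v (p \<box>\<rightarrow> q) =
     {w \<in> S. \<Union>(\<sigma> w) \<inter> truth S \<sigma> v p = {} \<or>
             (\<exists>U \<in> \<sigma> w. U \<inter> truth S \<sigma> v p \<noteq> {} \<and> U \<inter> truth S \<sigma> v p \<subseteq> truth S \<sigma> v q)}"

definition LTS :: "('w set \<times> ('w \<Rightarrow> 'w set set) \<times> ('v \<Rightarrow> 'w set)) set" where
  "LTS = {(topspace X, \<sigma>, v) | X \<sigma> v. topological_sphere X \<sigma> \<and> (\<forall>a. clopenin X (v a))}"

text \<open>HOL cannot quantify over all types inside a formula, so the type of which the worlds are
  elements is a parameter, passed as \<open>TYPE('w)\<close>.  Consequence over all Stone spaces whatsoever
  amounts to consequence at every \<open>'w\<close>.  The type \<open>'v fm set\<close> has room for the maximal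
  consistent sets of formulas.\<close>

definition LTS_conseq :: "'w itself \<Rightarrow> 'v fm set \<Rightarrow> 'v fm \<Rightarrow> bool" where
  "LTS_conseq _ G p \<longleftrightarrow>
     (\<forall>(S :: 'w set, \<sigma>, v) \<in> LTS.
        (\<forall>w\<in>S. \<forall>q\<in>G. w \<in> truth S \<sigma> v q) \<longrightarrow> (\<forall>w\<in>S. w \<in> truth S \<sigma> v p))"

abbreviation LTS_conseq_syntax :: "'v fm set \<Rightarrow> 'w itself \<Rightarrow> 'v fm \<Rightarrow> bool"
    (\<open>(_ \<Turnstile>\<^sub>L\<^sub>T\<^sub>S[_] _)\<close> [41, 0, 41] 40) where
  "G \<Turnstile>\<^sub>L\<^sub>T\<^sub>S[T] p \<equiv> LTS_conseq T G p"

end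

theory Submission
  imports Defs
begin

text \<open>Soundness uses nothing but the nestedness of the spheres.  For completeness, the
  maximal consistent theories above \<open>G\<close> form a Stone space, and in each world \<open>w\<close> the
  conditional selects from every clopen \<open>A\<close> a closed set \<open>f\<^sub>w(A) \<subseteq> A\<close> of closest worlds.
  The axioms say that \<open>f\<^sub>w(A) = f\<^sub>w(B) \<inter> A\<close> whenever \<open>A \<subseteq> B\<close> and \<open>f\<^sub>w(B)\<close> meets \<open>A\<close>, and this
  makes the sets \<open>\<Union>{f\<^sub>w(C). B \<subseteq> C}\<close> with \<open>f\<^sub>w(B) \<noteq> {}\<close> a nested family of spheres around
  \<open>w\<close> for which the closest \<open>A\<close>-worlds are exactly \<open>f\<^sub>w(A)\<close>.\<close>

section \<open>Soundness\<close>

lemma chain_subset_min3: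
  assumes "chain\<^sub>\<subseteq> \<C>" "U \<in> \<C>" "V \<in> \<C>" "W \<in> \<C>"
  obtains M where "M \<in> {U, V, W}" "M \<subseteq> U" "M \<subseteq> V" "M \<subseteq> W"
proof -
  have "U \<subseteq> V \<or> V \<subseteq> U" "U \<subseteq> W \<or> W \<subseteq> U" "V \<subseteq> W \<or> W \<subseteq> V"
    using assms unfolding chain_subset_def by blast+
  then show ?thesis using that by blast
qed

text \<open>The satisfaction clause of \<open>\<box>\<rightarrow>\<close> with the world replaced by
  its family of spheres, so that each Lewis axiom becomes a statement about one nested
  family.\<close>

definition cf_holds :: "'w set set \<Rightarrow> 'w set \<Rightarrow> 'w set \<Rightarrow> bool" where
  "cf_holds \<C> A B \<longleftrightarrow> \<Union>\<C> \<inter> A = {} \<or> (\<exists>U\<in>\<C>. U \<inter> A \<noteq> {} \<and> U \<inter> A \<subseteq> B)"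

lemma mem_truth_Cf: "w \<in> truth S \<sigma> v (p \<box>\<rightarrow> q) \<longleftrightarrow>
    w \<in> S \<and> cf_holds (\<sigma> w) (truth S \<sigma> v p) (truth S \<sigma> v q)"
  by (simp add: cf_holds_def)

lemma cf_holds_refl: "cf_holds \<C> A A"
  unfolding cf_holds_def by blast

text \<open>Rule \<open>C\<close> supplies an implication only at worlds. Spheres consist of worlds,
  hence the restriction of the inclusion to \<open>\<Union>\<C>\<close>.\<close>

lemma cf_holds_mono:
  assumes "cf_holds \<C> A B" "\<Union>\<C> \<inter> B \<subseteq> B'"
  shows "cf_holds \<C> A B'"
  using assms unfolding cf_holds_def by blast

text \<open>Of two witnessing spheres the smaller one witnesses both conclusions; nestedness thus
  gives L4.\<close>

lemma cf_holds_Int: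
  assumes "chain\<^sub>\<subseteq> \<C>"
  shows "cf_holds \<C> A (B \<inter> B') \<longleftrightarrow> cf_holds \<C> A B \<and> cf_holds \<C> A B'"
proof
  assume *: "cf_holds \<C> A B \<and> cf_holds \<C> A B'"
  show "cf_holds \<C> A (B \<inter> B')"
  proof (cases "\<Union>\<C> \<inter> A = {}")
    case False
    then obtain U V where UV: "U \<in> \<C>" "U \<inter> A \<noteq> {}" "U \<inter> A \<subseteq> B" "V \<in> \<C>" "V \<inter> A \<noteq> {}" "V \<inter> A \<subseteq> B'"
      using * unfolding cf_holds_def by blast
    moreover have "U \<subseteq> V \<or> V \<subseteq> U"
      using UV assms unfolding chain_subset_def by blast
    ultimately show ?thesis unfolding cf_holds_def by blast
  qed (simp add: cf_holds_def)
qed (auto simp: cf_holds_def)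

text \<open>One half of L2: inside the smallest of three witnessing spheres, \<open>A\<close> and
  \<open>B\<close> have the same nonempty part, and it lies in \<open>D\<close>.\<close>

lemma cf_holds_cong:
  assumes chain: "chain\<^sub>\<subseteq> \<C>" and AB: "cf_holds \<C> A B" and BA: "cf_holds \<C> B A"
    and AD: "cf_holds \<C> A D"
  shows "cf_holds \<C> B D"
proof (cases "\<Union>\<C> \<inter> A = {} \<or> \<Union>\<C> \<inter> B = {}")
  case True
  then show ?thesis using AB BA unfolding cf_holds_def by blast
next
  case False
  then obtain U V W where *: "U \<in> \<C>" "U \<inter> A \<noteq> {}" "U \<inter> A \<subseteq> B" "V \<in> \<C>" "V \<inter> B \<noteq> {}" "V \<inter> B \<subseteq> A"
      "W \<in> \<C>" "W \<inter> A \<noteq> {}" "W \<inter> A \<subseteq> D"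
    using AB BA AD unfolding cf_holds_def by blast
  obtain M where M: "M \<in> {U, V, W}" "M \<subseteq> U" "M \<subseteq> V" "M \<subseteq> W"
    using chain_subset_min3[OF chain *(1,4,7)] .
  \<comment> \<open>Clear if \<open>M\<close> is \<open>U\<close> or \<open>W\<close>; if
    \<open>M\<close> is \<open>V\<close>, it meets \<open>B\<close> and its \<open>B\<close>-worlds
    lie in \<open>A\<close>.\<close>
  then have "M \<inter> A \<noteq> {}" using * by blast
  then have "M \<in> \<C>" "M \<inter> B \<noteq> {}" "M \<inter> B \<subseteq> D" using * M by blast+
  then show ?thesis unfolding cf_holds_def by blast
qed

text \<open>The case of L3 in which its first two disjuncts fail. A sphere that meets
  \<open>A \<union> B\<close> but misses one of the two sets would verify one of those disjuncts, so
  it must meet both.\<close>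

lemma cf_holds_Un:
  assumes chain: "chain\<^sub>\<subseteq> \<C>" and A: "\<not> cf_holds \<C> (A \<union> B) A" and B: "\<not> cf_holds \<C> (A \<union> B) B"
  shows "cf_holds \<C> (A \<union> B) D \<longleftrightarrow> cf_holds \<C> A D \<and> cf_holds \<C> B D"
proof -
  have both: "U \<inter> A \<noteq> {} \<and> U \<inter> B \<noteq> {}" if "U \<in> \<C>" "U \<inter> (A \<union> B) \<noteq> {}" for U
    using that A B unfolding cf_holds_def by blast
  have ex: "\<Union>\<C> \<inter> A \<noteq> {}" "\<Union>\<C> \<inter> B \<noteq> {}"
    using A B both unfolding cf_holds_def by blast+
  show ?thesis
  proof
    assume "cf_holds \<C> (A \<union> B) D"
    then obtain U where "U \<in> \<C>" "U \<inter> (A \<union> B) \<noteq> {}" "U \<inter> (A \<union> B) \<subseteq> D"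
      using ex unfolding cf_holds_def by blast
    with both[of U] have "U \<in> \<C>" "U \<inter> A \<noteq> {}" "U \<inter> A \<subseteq> D" "U \<inter> B \<noteq> {}" "U \<inter> B \<subseteq> D"
      by auto
    then show "cf_holds \<C> A D \<and> cf_holds \<C> B D"
      unfolding cf_holds_def by blast
  next
    assume "cf_holds \<C> A D \<and> cf_holds \<C> B D"
    then obtain U V where UV: "U \<in> \<C>" "U \<inter> A \<noteq> {}" "U \<inter> A \<subseteq> D" "V \<in> \<C>" "V \<inter> B \<noteq> {}" "V \<inter> B \<subseteq> D"
      using ex unfolding cf_holds_def by blast
    moreover have "U \<subseteq> V \<or> V \<subseteq> U"
      using UV chain unfolding chain_subset_def by blast
    ultimately show "cf_holds \<C> (A \<union> B) D" unfolding cf_holds_def by blast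
  qed
qed

section \<open>Validity of the axioms and rules\<close>

lemma truth_classical_axiom:
  assumes "p \<in> classical_axioms" "w \<in> S"
  shows "w \<in> truth S \<sigma> v p"
  using assms by cases auto

lemma truth_lewis_axiom:
  assumes "p \<in> lewis_axioms" "w \<in> S" and chain: "chain\<^sub>\<subseteq> (\<sigma> w)"
  shows "w \<in> truth S \<sigma> v p"
  using assms(1)
proof cases
  case L1
  then show ?thesis using \<open>w \<in> S\<close> by (simp only: mem_truth_Cf cf_holds_refl simp_thms)
next
  case L2
  then show ?thesis using \<open>w \<in> S\<close>
    by (auto simp: mem_truth_Cf simp del: truth.simps(7) dest: cf_holds_cong[OF chain])
next
  case L3
  then show ?thesis using \<open>w \<in> S\<close> cf_holds_Un[OF chain]
    by (auto simp: mem_truth_Cf simp del: truth.simps(7))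
next
  case L4
  then show ?thesis using \<open>w \<in> S\<close>
    by (auto simp: mem_truth_Cf cf_holds_Int[OF chain] simp del: truth.simps(7))
qed

text \<open>The induction covers all worlds at once, since rule \<open>C\<close> passes from
  \<open>w\<close> to the worlds in its spheres.\<close>

lemma GV_sound:
  assumes chain: "\<And>w. w \<in> S \<Longrightarrow> chain\<^sub>\<subseteq> (\<sigma> w)" and sub: "\<And>w. w \<in> S \<Longrightarrow> \<Union>(\<sigma> w) \<subseteq> S"
    and G: "\<And>w q. w \<in> S \<Longrightarrow> q \<in> G \<Longrightarrow> w \<in> truth S \<sigma> v q"
    and "G \<turnstile>\<^sub>G\<^sub>V p" "w \<in> S"
  shows "w \<in> truth S \<sigma> v p"
  using assms(4,5)
proof (induction arbitrary: w rule: GV.induct)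
  case (C p q r)
  have "w \<in> truth S \<sigma> v (r \<box>\<rightarrow> q)" if "w \<in> truth S \<sigma> v (r \<box>\<rightarrow> p)"
  proof -
    have "\<Union>(\<sigma> w) \<inter> truth S \<sigma> v p \<subseteq> truth S \<sigma> v q"
      using C.IH sub[OF C.prems] by fastforce
    then show ?thesis using that cf_holds_mono unfolding mem_truth_Cf by blast
  qed
  then show ?case using C.prems by auto
qed (use G chain truth_classical_axiom truth_lewis_axiom in \<open>fastforce+\<close>)

lemma GV_sound_LTS:
  fixes G :: "'v fm set" and T :: "'w itself"
  assumes "G \<turnstile>\<^sub>G\<^sub>V p"
  shows "G \<Turnstile>\<^sub>L\<^sub>T\<^sub>S[T] p"
proof -
  have "w \<in> truth S \<sigma> v p"
    if LTS: "(S, \<sigma>, v) \<in> LTS" and G: "\<forall>w\<in>S. \<forall>q\<in>G. w \<in> truth S \<sigma> v q" and w: "w \<in> S"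
    for S :: "'w set" and \<sigma> v w
  proof (rule GV_sound[OF _ _ _ assms w])
    obtain X where X: "S = topspace X" "topological_sphere X \<sigma>"
      using LTS unfolding LTS_def by blast
    then show "chain\<^sub>\<subseteq> (\<sigma> u)" "\<Union>(\<sigma> u) \<subseteq> S" if "u \<in> S" for u
      using that unfolding topological_sphere_def by blast+
  qed (use G in blast)
  then show ?thesis unfolding LTS_conseq_def by blast
qed

section \<open>Spheres from selection functions\<close>

locale selection =
  fixes \<B> :: "'w set set" and f :: "'w set \<Rightarrow> 'w set"
  assumes Un_mem: "A \<in> \<B> \<Longrightarrow> B \<in> \<B> \<Longrightarrow> A \<union> B \<in> \<B>"
    and Diff_mem: "A \<in> \<B> \<Longrightarrow> B \<in> \<B> \<Longrightarrow> A - B \<in> \<B>"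
    and sel_subset: "A \<in> \<B> \<Longrightarrow> f A \<subseteq> A"
    and sel_cong: "A \<in> \<B> \<Longrightarrow> B \<in> \<B> \<Longrightarrow> f A \<subseteq> B \<Longrightarrow> f B \<subseteq> A \<Longrightarrow> f A = f B"
    and sel_Un: "A \<in> \<B> \<Longrightarrow> B \<in> \<B> \<Longrightarrow>
      f (A \<union> B) \<subseteq> A \<or> f (A \<union> B) \<subseteq> B \<or> f (A \<union> B) = f A \<union> f B"
begin

lemma sel_empty:
  assumes "A \<in> \<B>" "B \<in> \<B>" "A \<subseteq> B" "f B = {}"
  shows "f A = {}"
  using sel_cong[of B A] sel_subset[of A] assms by auto

text \<open>Apply \<open>sel_Un\<close> to the partition of \<open>B\<close> into \<open>A\<close>
  and \<open>B - A\<close>. The first alternative is settled by \<open>sel_cong\<close>, the second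
  contradicts \<open>ne\<close>, and in the third \<open>f (B - A)\<close> is disjoint from
  \<open>A\<close>.\<close>

lemma sel_restrict:
  assumes "A \<in> \<B>" "B \<in> \<B>" "A \<subseteq> B" and ne: "f B \<inter> A \<noteq> {}"
  shows "f A = f B \<inter> A"
proof -
  have D: "B - A \<in> \<B>" and eq: "A \<union> (B - A) = B" using Diff_mem assms by auto
  have "f B \<subseteq> A \<or> f B \<subseteq> B - A \<or> f B = f A \<union> f (B - A)"
    using sel_Un[OF assms(1) D] eq by simp
  moreover have "f A = f B" if "f B \<subseteq> A"
    using sel_cong[of A B] sel_subset[of A] assms that by blast
  ultimately show ?thesis using ne sel_subset[OF assms(1)] sel_subset[OF D] by blast
qed

text \<open>Enlarging \<open>B\<close> only adds competitors, so a world selected from a superset of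
  \<open>B\<close> counts as at least as close as the selected \<open>B\<close>-worlds.\<close>

definition sphere :: "'w set \<Rightarrow> 'w set" where
  "sphere B = \<Union>(f ` {C \<in> \<B>. B \<subseteq> C})"

definition spheres :: "'w set set" where
  "spheres = sphere ` {B \<in> \<B>. f B \<noteq> {}}"

text \<open>By \<open>sel_restrict\<close> a superset of \<open>B\<close> contributes to
  \<open>B\<close> either nothing or exactly \<open>f B\<close>, and \<open>B\<close> itself
  contributes \<open>f B\<close>.\<close>

lemma sphere_Int: "B \<in> \<B> \<Longrightarrow> sphere B \<inter> B = f B"
  unfolding sphere_def using sel_restrict[of B] sel_subset[of B] by blast

text \<open>The hypothesis \<open>ne\<close> expresses that \<open>A\<close> is at least as close as
  \<open>B\<close>. A world selected from some \<open>C\<close> above \<open>A\<close> is then still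
  selected from \<open>C \<union> B\<close>, which lies above \<open>B\<close>.\<close>

lemma sphere_mono:
  assumes A: "A \<in> \<B>" and B: "B \<in> \<B>" and ne: "f (A \<union> B) \<inter> A \<noteq> {}"
  shows "sphere A \<subseteq> sphere B"
proof
  fix x assume "x \<in> sphere A"
  then obtain C where C: "C \<in> \<B>" "A \<subseteq> C" "x \<in> f C" unfolding sphere_def by blast
  have CB: "C \<union> B \<in> \<B>" and AB: "A \<union> B \<in> \<B>" using A B C Un_mem by auto
  have "f (C \<union> B) \<inter> C \<noteq> {}"
  proof
    assume 0: "f (C \<union> B) \<inter> C = {}"
    \<comment> \<open>A selection from \<open>C \<union> B\<close> that misses \<open>C\<close> lies
      in \<open>B\<close>, so its restriction \<open>f (A \<union> B)\<close> would miss
      \<open>C\<close> and hence \<open>A\<close>.\<close>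
    have "f (C \<union> B) \<noteq> {}" using sel_empty[OF C(1) CB] C by blast
    then have "f (C \<union> B) \<inter> (A \<union> B) \<noteq> {}" using 0 sel_subset[OF CB] by blast
    then have "f (A \<union> B) = f (C \<union> B) \<inter> (A \<union> B)" using sel_restrict[OF AB CB] C by blast
    then show False using 0 C ne by blast
  qed
  then have "x \<in> f (C \<union> B)" using sel_restrict[OF C(1) CB] C by blast
  then show "x \<in> sphere B" unfolding sphere_def using CB by blast
qed

text \<open>A witness in \<open>f C \<inter> A\<close> shows that \<open>f (C \<union> A)\<close>
  meets \<open>A\<close>: either \<open>f (C \<union> A)\<close> misses \<open>C\<close> and lies in
  \<open>A\<close>, or it restricts to \<open>f C\<close>. Restricting further to
  \<open>A \<union> B\<close> gives the claim.\<close>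

lemma sphere_meets:
  assumes A: "A \<in> \<B>" and B: "B \<in> \<B>" and ne: "sphere B \<inter> A \<noteq> {}"
  shows "f (A \<union> B) \<inter> A \<noteq> {}"
proof -
  obtain C x where C: "C \<in> \<B>" "B \<subseteq> C" "x \<in> f C" "x \<in> A" using ne unfolding sphere_def by blast
  have CA: "C \<union> A \<in> \<B>" and AB: "A \<union> B \<in> \<B>" using A B C Un_mem by auto
  have restr: "f (A \<union> B) = f (C \<union> A) \<inter> (A \<union> B)" if "f (C \<union> A) \<inter> A \<noteq> {}"
    using sel_restrict[OF AB CA] C that by blast
  have "f (C \<union> A) \<inter> A \<noteq> {}"
  proof (cases "f (C \<union> A) \<inter> C = {}")
    case True
    then show ?thesis using sel_empty[OF C(1) CA] sel_subset[OF CA] C by blast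
  next
    case False
    then show ?thesis using sel_restrict[OF C(1) CA] C by blast
  qed
  then show ?thesis using restr by blast
qed

text \<open>The nonempty set \<open>f (A \<union> B)\<close> meets \<open>A\<close> or
  \<open>B\<close>, and either case orders the two spheres by \<open>sphere_mono\<close>.\<close>

lemma chain_spheres: "chain\<^sub>\<subseteq> spheres"
proof -
  have "sphere A \<subseteq> sphere B \<or> sphere B \<subseteq> sphere A"
    if "A \<in> \<B>" "f A \<noteq> {}" "B \<in> \<B>" "f B \<noteq> {}" for A B
  proof -
    have AB: "A \<union> B \<in> \<B>" using Un_mem that by blast
    then have "f (A \<union> B) \<noteq> {}" using sel_empty[of A "A \<union> B"] that by blast
    then have "f (A \<union> B) \<inter> A \<noteq> {} \<or> f (B \<union> A) \<inter> B \<noteq> {}"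
      using sel_subset[OF AB] by (auto simp: Un_commute)
    then show ?thesis using sphere_mono that by blast
  qed
  then show ?thesis unfolding chain_subset_def spheres_def by blast
qed

lemma Union_spheres_subset: "\<Union>spheres \<subseteq> \<Union>\<B>"
  unfolding spheres_def sphere_def using sel_subset by blast

text \<open>Source of the limit assumption: by \<open>sphere_meets\<close>, any sphere that meets
  \<open>A\<close> yields the hypothesis of \<open>sphere_mono\<close>.\<close>

lemma sphere_least:
  assumes "A \<in> \<B>" "V \<in> spheres" "V \<inter> A \<noteq> {}"
  shows "sphere A \<in> spheres" "sphere A \<inter> A \<noteq> {}" "sphere A \<subseteq> V"
proof -
  obtain B where B: "B \<in> \<B>" "f B \<noteq> {}" "V = sphere B" using assms unfolding spheres_def by blast
  have ne: "f (A \<union> B) \<inter> A \<noteq> {}" using sphere_meets assms B by blast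
  have "f A \<noteq> {}" using sel_restrict[of A "A \<union> B"] ne assms B Un_mem by auto
  then show "sphere A \<in> spheres" "sphere A \<inter> A \<noteq> {}" "sphere A \<subseteq> V"
    using assms B ne sphere_mono sphere_Int unfolding spheres_def by auto
qed

text \<open>The equation for \<open>\<sigma>\<close> is asked only at \<open>x\<close>, because each
  world has its own selection function.\<close>

lemma closest_spheres:
  assumes "\<sigma> x = spheres" and A: "A \<in> \<B>"
  shows "closest \<sigma> A x = f A"
proof (cases "A \<inter> \<Union>spheres = {}")
  case True
  then have "f A = {}" using sphere_Int[OF A] A unfolding spheres_def by blast
  then show ?thesis using True assms by (simp add: closest_def)
next
  case False
  then obtain V where "V \<in> spheres" "V \<inter> A \<noteq> {}" by blast
  then have "\<Inter>{U \<in> spheres. U \<inter> A \<noteq> {}} = sphere A" using sphere_least[OF A] by blast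
  then show ?thesis using False assms sphere_Int[OF A] by (auto simp: closest_def)
qed

end

text \<open>Under the limit assumption the least sphere that meets \<open>A\<close> decides the
  existential clause; the empty value of \<open>closest\<close> matches the vacuous clause.\<close>

lemma cf_holds_closest:
  assumes "A \<inter> \<Union>(\<sigma> x) \<noteq> {} \<Longrightarrow> \<exists>U\<in>\<sigma> x. U \<inter> A \<noteq> {} \<and> (\<forall>V\<in>\<sigma> x. V \<inter> A \<noteq> {} \<longrightarrow> U \<subseteq> V)"
  shows "cf_holds (\<sigma> x) A B \<longleftrightarrow> closest \<sigma> A x \<subseteq> B"
proof (cases "A \<inter> \<Union>(\<sigma> x) = {}")
  case True
  then show ?thesis by (auto simp: closest_def cf_holds_def)
next
  case False
  then obtain U where U: "U \<in> \<sigma> x" "U \<inter> A \<noteq> {}" "\<forall>V\<in>\<sigma> x. V \<inter> A \<noteq> {} \<longrightarrow> U \<subseteq> V"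
    using assms by blast
  then have "\<Inter>{U \<in> \<sigma> x. U \<inter> A \<noteq> {}} = U" by blast
  then have "closest \<sigma> A x = A \<inter> U" using False by (simp add: closest_def)
  moreover have "cf_holds (\<sigma> x) A B \<longleftrightarrow> A \<inter> U \<subseteq> B"
    using U False unfolding cf_holds_def by blast
  ultimately show ?thesis by simp
qed

section \<open>The Stone space of maximal theories\<close>

text \<open>Closure under modus ponens only: rule \<open>C\<close> preserves truth at all worlds,
  not truth at one, so it enters only through what is derivable from \<open>G\<close>.\<close>

definition theory_over :: "'v fm set \<Rightarrow> 'v fm set \<Rightarrow> bool" where
  "theory_over G X \<longleftrightarrow> {p. G \<turnstile>\<^sub>G\<^sub>V p} \<subseteq> X \<and> (\<forall>p q. p \<^bold>\<rightarrow> q \<in> X \<longrightarrow> p \<in> X \<longrightarrow> q \<in> X)"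

definition worlds :: "'v fm set \<Rightarrow> 'v fm set set" where
  "worlds G = {w. theory_over G w \<and> Bot \<notin> w \<and> (\<forall>p. p \<in> w \<or> p \<^bold>\<rightarrow> Bot \<in> w)}"

definition ext :: "'v fm set \<Rightarrow> 'v fm \<Rightarrow> 'v fm set set" where
  "ext G p = {w \<in> worlds G. p \<in> w}"

lemma theory_MP: "theory_over G X \<Longrightarrow> p \<^bold>\<rightarrow> q \<in> X \<Longrightarrow> p \<in> X \<Longrightarrow> q \<in> X"
  unfolding theory_over_def by blast

lemma theory_GV: "theory_over G X \<Longrightarrow> G \<turnstile>\<^sub>G\<^sub>V p \<Longrightarrow> p \<in> X"
  unfolding theory_over_def by blast

lemma theory_Cl: "theory_over G X \<Longrightarrow> p \<in> classical_axioms \<Longrightarrow> p \<in> X"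
  by (simp add: GV.Cl theory_GV)

lemma theory_theorems: "theory_over G {p. G \<turnstile>\<^sub>G\<^sub>V p}"
  unfolding theory_over_def by (auto intro: GV.MP)

text \<open>A deduction theorem: the set is the theory generated by \<open>X\<close> and
  \<open>p\<close>. It works because theories need not be closed under rule
  \<open>C\<close>.\<close>

lemma theory_adjoin:
  assumes X: "theory_over G X"
  shows "theory_over G {r. p \<^bold>\<rightarrow> r \<in> X}" "X \<subseteq> {r. p \<^bold>\<rightarrow> r \<in> X}" "p \<^bold>\<rightarrow> p \<in> X"
proof -
  have K: "q \<^bold>\<rightarrow> (r \<^bold>\<rightarrow> q) \<in> X" for q r
    using theory_Cl[OF X classical_axioms.K] .
  have S: "(p \<^bold>\<rightarrow> (q \<^bold>\<rightarrow> r)) \<^bold>\<rightarrow> ((p \<^bold>\<rightarrow> q) \<^bold>\<rightarrow> (p \<^bold>\<rightarrow> r)) \<in> X" for q r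
    using theory_Cl[OF X classical_axioms.S] .
  show sub: "X \<subseteq> {r. p \<^bold>\<rightarrow> r \<in> X}" using theory_MP[OF X K] by blast
  show "theory_over G {r. p \<^bold>\<rightarrow> r \<in> X}"
    using sub theory_MP[OF X theory_MP[OF X S]] X unfolding theory_over_def by blast
  show "p \<^bold>\<rightarrow> p \<in> X"
    using theory_MP[OF X theory_MP[OF X S[of "p \<^bold>\<rightarrow> p" p]]] K by blast
qed

text \<open>Adjoin the negation of \<open>q\<close>, then \<open>p\<close>. A contradiction in
  \<open>Z\<close> puts the negation of \<open>p\<close> into \<open>Y\<close>, hence
  \<open>q\<close> and \<open>Bot\<close> too, and double negation finishes.\<close>

lemma theory_excluded_middle:
  assumes X: "theory_over G X" and "p \<^bold>\<rightarrow> q \<in> X" "(p \<^bold>\<rightarrow> Bot) \<^bold>\<rightarrow> q \<in> X"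
  shows "q \<in> X"
proof -
  let ?n = "q \<^bold>\<rightarrow> Bot"
  define Y where "Y = {r. ?n \<^bold>\<rightarrow> r \<in> X}"
  have Y: "theory_over G Y" and XY: "X \<subseteq> Y" and n: "?n \<in> Y"
    unfolding Y_def using theory_adjoin[OF X, of ?n] by auto
  define Z where "Z = {r. p \<^bold>\<rightarrow> r \<in> Y}"
  have Z: "theory_over G Z" and YZ: "Y \<subseteq> Z" and p: "p \<in> Z"
    unfolding Z_def using theory_adjoin[OF Y, of p] by auto
  have "q \<in> Z" using theory_MP[OF Z] p assms XY YZ by blast
  then have "Bot \<in> Z" using theory_MP[OF Z] n YZ by blast
  then have "p \<^bold>\<rightarrow> Bot \<in> Y" unfolding Z_def by simp
  then have "q \<in> Y" using theory_MP[OF Y] assms XY by blast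
  then have "Bot \<in> Y" using theory_MP[OF Y] n by blast
  then show ?thesis
    using theory_MP[OF X theory_Cl[OF X classical_axioms.DN]] unfolding Y_def by simp
qed

text \<open>Zorn's lemma is applied to theories that omit \<open>q\<close>, not merely to consistent
  ones, so that the maximal theory omits \<open>q\<close> as well.\<close>

lemma lindenbaum:
  assumes X: "theory_over G X" and "q \<notin> X"
  obtains w where "w \<in> worlds G" "X \<subseteq> w" "q \<notin> w"
proof -
  define P where "P = {Y. theory_over G Y \<and> X \<subseteq> Y \<and> q \<notin> Y}"
  have "\<exists>M\<in>P. \<forall>Y\<in>P. M \<subseteq> Y \<longrightarrow> Y = M"
  proof (rule subset_Zorn_nonempty)
    show "P \<noteq> {}" using assms unfolding P_def by blast
    fix \<C> assume ne: "\<C> \<noteq> {}" and chain: "subset.chain P \<C>"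
    have mem: "theory_over G Y \<and> X \<subseteq> Y \<and> q \<notin> Y" if "Y \<in> \<C>" for Y
      using that chain unfolding subset_chain_def P_def by blast
    have "r \<in> \<Union>\<C>" if "s \<^bold>\<rightarrow> r \<in> \<Union>\<C>" "s \<in> \<Union>\<C>" for r s
    proof -
      from that obtain Y Z where YZ: "Y \<in> \<C>" "s \<^bold>\<rightarrow> r \<in> Y" "Z \<in> \<C>" "s \<in> Z" by blast
      moreover have "Y \<subseteq> Z \<or> Z \<subseteq> Y" using YZ chain unfolding subset_chain_def by blast
      ultimately have "\<exists>Y\<in>\<C>. s \<^bold>\<rightarrow> r \<in> Y \<and> s \<in> Y" by blast
      then show ?thesis using mem theory_MP by blast
    qed
    moreover have "{p. G \<turnstile>\<^sub>G\<^sub>V p} \<subseteq> \<Union>\<C>" using ne mem unfolding theory_over_def by blast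
    ultimately have "theory_over G (\<Union>\<C>)" unfolding theory_over_def by blast
    then show "\<Union>\<C> \<in> P" using ne mem unfolding P_def by blast
  qed
  then obtain M where M: "theory_over G M" "X \<subseteq> M" "q \<notin> M"
    and max: "\<And>Y. theory_over G Y \<Longrightarrow> M \<subseteq> Y \<Longrightarrow> q \<notin> Y \<Longrightarrow> Y = M"
    unfolding P_def by (smt (verit, best) mem_Collect_eq order_trans)
  \<comment> \<open>Adjoining a missing \<open>p\<close> must produce \<open>q\<close> by
    maximality. If \<open>p\<close> and its negation were both missing, excluded middle would put
    \<open>q\<close> into \<open>M\<close>.\<close>
  have imp: "p \<^bold>\<rightarrow> q \<in> M" if "p \<notin> M" for p
    using max[of "{r. p \<^bold>\<rightarrow> r \<in> M}"] theory_adjoin[OF M(1), of p] that by blast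
  have "p \<in> M \<or> p \<^bold>\<rightarrow> Bot \<in> M" for p
    using imp theory_excluded_middle[OF M(1)] M(3) by blast
  moreover have "Bot \<notin> M"
    using theory_MP[OF M(1) theory_Cl[OF M(1) classical_axioms.BotE]] M(3) by blast
  ultimately have "M \<in> worlds G" unfolding worlds_def using M(1) by blast
  then show ?thesis using that M by blast
qed

lemma world_theory: "w \<in> worlds G \<Longrightarrow> theory_over G w"
  unfolding worlds_def by blast

lemma world_Bot: "w \<in> worlds G \<Longrightarrow> Bot \<notin> w"
  unfolding worlds_def by blast

lemma world_Top: "w \<in> worlds G \<Longrightarrow> Top \<in> w"
  using theory_Cl[OF world_theory classical_axioms.TopI] .

lemma world_Impl:
  assumes w: "w \<in> worlds G"
  shows "p \<^bold>\<rightarrow> q \<in> w \<longleftrightarrow> (p \<in> w \<longrightarrow> q \<in> w)"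
proof -
  note T = world_theory[OF w]
  have "p \<^bold>\<rightarrow> q \<in> w" if "p \<notin> w"
  proof -
    have "p \<^bold>\<rightarrow> Bot \<in> w" using w that unfolding worlds_def by blast
    moreover have "p \<^bold>\<rightarrow> (Bot \<^bold>\<rightarrow> q) \<in> w"
      using theory_MP[OF T theory_Cl[OF T classical_axioms.K]] theory_Cl[OF T classical_axioms.BotE] .
    ultimately show ?thesis
      using theory_MP[OF T theory_MP[OF T theory_Cl[OF T classical_axioms.S]]] by blast
  qed
  then show ?thesis
    using theory_MP[OF T] theory_MP[OF T theory_Cl[OF T classical_axioms.K]] by blast
qed

lemma world_Conj:
  assumes w: "w \<in> worlds G"
  shows "p \<^bold>\<and> q \<in> w \<longleftrightarrow> p \<in> w \<and> q \<in> w"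
  using theory_Cl[OF world_theory[OF w] classical_axioms.ConjE1[of p q]]
    theory_Cl[OF world_theory[OF w] classical_axioms.ConjE2[of p q]]
    theory_Cl[OF world_theory[OF w] classical_axioms.ConjI[of p q]]
  unfolding world_Impl[OF w] by blast

lemma world_Disj:
  assumes w: "w \<in> worlds G"
  shows "p \<^bold>\<or> q \<in> w \<longleftrightarrow> p \<in> w \<or> q \<in> w"
  using theory_Cl[OF world_theory[OF w] classical_axioms.DisjI1[of p q]]
    theory_Cl[OF world_theory[OF w] classical_axioms.DisjI2[of q p]]
    theory_Cl[OF world_theory[OF w] classical_axioms.DisjE[of p Bot q]] world_Bot[OF w]
  unfolding world_Impl[OF w] by blast

lemma GV_iff_worlds: "G \<turnstile>\<^sub>G\<^sub>V p \<longleftrightarrow> (\<forall>w\<in>worlds G. p \<in> w)"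
proof
  show "\<forall>w\<in>worlds G. p \<in> w" if "G \<turnstile>\<^sub>G\<^sub>V p"
    using theory_GV[OF world_theory that] by blast
  show "G \<turnstile>\<^sub>G\<^sub>V p" if "\<forall>w\<in>worlds G. p \<in> w"
  proof (rule ccontr)
    assume "\<not> G \<turnstile>\<^sub>G\<^sub>V p"
    then obtain w where "w \<in> worlds G" "p \<notin> w"
      using lindenbaum[OF theory_theorems, of p G] by (metis mem_Collect_eq)
    then show False using that by blast
  qed
qed

lemma ext_Impl: "ext G (p \<^bold>\<rightarrow> q) = (worlds G - ext G p) \<union> ext G q"
  unfolding ext_def by (auto simp: world_Impl)

lemma ext_Conj: "ext G (p \<^bold>\<and> q) = ext G p \<inter> ext G q"
  unfolding ext_def by (auto simp: world_Conj)

lemma ext_Disj: "ext G (p \<^bold>\<or> q) = ext G p \<union> ext G q"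
  unfolding ext_def by (auto simp: world_Disj)

lemma ext_Bot: "ext G Bot = {}"
  unfolding ext_def by (auto simp: world_Bot)

lemma ext_Top: "ext G Top = worlds G"
  unfolding ext_def by (auto simp: world_Top)

lemma GV_Impl_iff: "G \<turnstile>\<^sub>G\<^sub>V p \<^bold>\<rightarrow> q \<longleftrightarrow> ext G p \<subseteq> ext G q"
  unfolding GV_iff_worlds ext_def by (auto simp: world_Impl)

section \<open>The topology with the extensions of formulas as a base\<close>

definition world_space :: "'v fm set \<Rightarrow> 'v fm set topology" where
  "world_space G = topology (\<lambda>U. U \<subseteq> worlds G \<and> (\<forall>w\<in>U. \<exists>p\<in>w. ext G p \<subseteq> U))"

lemma openin_world_space:
  "openin (world_space G) U \<longleftrightarrow> U \<subseteq> worlds G \<and> (\<forall>w\<in>U. \<exists>p\<in>w. ext G p \<subseteq> U)"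
proof -
  have "istopology (\<lambda>U. U \<subseteq> worlds G \<and> (\<forall>w\<in>U. \<exists>p\<in>w. ext G p \<subseteq> U))"
    unfolding istopology_def
  proof (intro conjI allI impI ballI)
    fix U V w
    assume U: "U \<subseteq> worlds G \<and> (\<forall>w\<in>U. \<exists>p\<in>w. ext G p \<subseteq> U)"
      and V: "V \<subseteq> worlds G \<and> (\<forall>w\<in>V. \<exists>p\<in>w. ext G p \<subseteq> V)" and w: "w \<in> U \<inter> V"
    have "\<exists>p\<in>w. ext G p \<subseteq> U" "\<exists>p\<in>w. ext G p \<subseteq> V" using U V w by auto
    then obtain p q where "p \<in> w" "ext G p \<subseteq> U" "q \<in> w" "ext G q \<subseteq> V" by auto
    moreover have "w \<in> worlds G" using U w by blast
    ultimately have "p \<^bold>\<and> q \<in> w" "ext G (p \<^bold>\<and> q) \<subseteq> U \<inter> V"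
      by (auto simp: world_Conj ext_Conj)
    then show "\<exists>p\<in>w. ext G p \<subseteq> U \<inter> V" by blast
  next
    fix \<K> w
    assume K: "\<forall>U\<in>\<K>. U \<subseteq> worlds G \<and> (\<forall>w\<in>U. \<exists>p\<in>w. ext G p \<subseteq> U)" and "w \<in> \<Union>\<K>"
    then obtain U where U: "U \<in> \<K>" "w \<in> U" by blast
    then obtain p where "p \<in> w" "ext G p \<subseteq> U" using K by metis
    then show "\<exists>p\<in>w. ext G p \<subseteq> \<Union>\<K>" using U by blast
  qed auto
  then show ?thesis unfolding world_space_def by (simp add: topology_inverse')
qed

lemma openin_ext: "openin (world_space G) (ext G p)"
  unfolding openin_world_space by (auto simp: ext_def)

lemma topspace_world_space: "topspace (world_space G) = worlds G"
  using openin_ext[of G Top] openin_world_space[of G "topspace (world_space G)"]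
  by (auto simp: ext_Top dest: openin_subset)

lemma clopenin_ext: "clopenin (world_space G) (ext G p)"
proof -
  have "ext G (p \<^bold>\<rightarrow> Bot) = topspace (world_space G) - ext G p"
    by (simp add: ext_Impl ext_Bot topspace_world_space)
  then have "closedin (world_space G) (ext G p)"
    unfolding closedin_def using openin_ext[of G "p \<^bold>\<rightarrow> Bot"]
    by (auto simp: topspace_world_space ext_def)
  then show ?thesis by (simp add: clopenin_def openin_ext)
qed

lemma worlds_separated:
  assumes "u \<in> worlds G" "w \<in> worlds G" "u \<noteq> w"
  obtains p where "u \<in> ext G p" "w \<in> ext G (p \<^bold>\<rightarrow> Bot)"
proof -
  obtain q where "q \<in> u \<and> q \<notin> w \<or> q \<notin> u \<and> q \<in> w" using assms by blast
  \<comment> \<open>A formula in \<open>w\<close> but not in \<open>u\<close> is replaced by its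
    negation.\<close>
  then have "u \<in> ext G q \<and> w \<in> ext G (q \<^bold>\<rightarrow> Bot) \<or>
      u \<in> ext G (q \<^bold>\<rightarrow> Bot) \<and> w \<in> ext G ((q \<^bold>\<rightarrow> Bot) \<^bold>\<rightarrow> Bot)"
    using assms by (auto simp: ext_def world_Impl world_Bot)
  then show ?thesis using that by blast
qed

lemma compact_world_space: "compact_space (world_space G)"
  unfolding compact_space
proof (intro allI impI, elim conjE)
  fix \<U> assume opn: "\<forall>U\<in>\<U>. openin (world_space G) U" and cover: "\<Union>\<U> = topspace (world_space G)"
  \<comment> \<open>The formulas true outside some finite part of the cover. A world containing all
    of \<open>X\<close> would escape the whole cover, so \<open>X\<close> is inconsistent and some
    finite part covers everything.\<close>
  define X where "X = {r. \<exists>\<F>. finite \<F> \<and> \<F> \<subseteq> \<U> \<and> worlds G - \<Union>\<F> \<subseteq> ext G r}"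
  have X: "theory_over G X"
    unfolding theory_over_def
  proof (intro conjI allI impI subsetI)
    fix p assume "p \<in> {p. G \<turnstile>\<^sub>G\<^sub>V p}"
    then have "worlds G - \<Union>{} \<subseteq> ext G p" by (auto simp: GV_iff_worlds ext_def)
    then show "p \<in> X" unfolding X_def by blast
  next
    fix p q assume "p \<^bold>\<rightarrow> q \<in> X" "p \<in> X"
    then obtain E F where *: "finite E" "E \<subseteq> \<U>" "worlds G - \<Union>E \<subseteq> ext G (p \<^bold>\<rightarrow> q)"
        "finite F" "F \<subseteq> \<U>" "worlds G - \<Union>F \<subseteq> ext G p"
      unfolding X_def by auto
    then have "finite (E \<union> F)" "E \<union> F \<subseteq> \<U>" "worlds G - \<Union>(E \<union> F) \<subseteq> ext G q"
      by (auto simp: ext_Impl)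
    then show "q \<in> X" unfolding X_def by blast
  qed
  have "Bot \<in> X"
  proof (rule ccontr)
    assume "Bot \<notin> X"
    then obtain w where w: "w \<in> worlds G" "X \<subseteq> w" using lindenbaum[OF X] by blast
    then obtain U where U: "U \<in> \<U>" "w \<in> U" using cover by (auto simp: topspace_world_space)
    then obtain p where p: "p \<in> w" "ext G p \<subseteq> U" using opn unfolding openin_world_space by blast
    have "worlds G - \<Union>{U} \<subseteq> ext G (p \<^bold>\<rightarrow> Bot)" using p by (auto simp: ext_Impl)
    then have "p \<^bold>\<rightarrow> Bot \<in> X" unfolding X_def using U by blast
    then show False using w p world_Impl[OF w(1)] world_Bot[OF w(1)] by blast
  qed
  then obtain \<F> where "finite \<F>" "\<F> \<subseteq> \<U>" "worlds G \<subseteq> \<Union>\<F>"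
    unfolding X_def by (auto simp: ext_Bot)
  then show "\<exists>\<F>. finite \<F> \<and> \<F> \<subseteq> \<U> \<and> \<Union>\<F> = topspace (world_space G)"
    using cover by (metis Union_mono subset_antisym topspace_world_space)
qed

lemma Stone_world_space: "Stone_space (world_space G)"
  unfolding Stone_space_def
proof (intro conjI allI impI ballI)
  show "compact_space (world_space G)" by (rule compact_world_space)
  show "Hausdorff_space (world_space G)"
    unfolding Hausdorff_space_def topspace_world_space
  proof (intro allI impI)
    fix u w assume "u \<in> worlds G \<and> w \<in> worlds G \<and> u \<noteq> w"
    then obtain p where "u \<in> ext G p" "w \<in> ext G (p \<^bold>\<rightarrow> Bot)" using worlds_separated by metis
    moreover have "disjnt (ext G p) (ext G (p \<^bold>\<rightarrow> Bot))"
      by (auto simp: disjnt_def ext_Impl ext_Bot)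
    ultimately show "\<exists>U V. openin (world_space G) U \<and> openin (world_space G) V \<and>
        u \<in> U \<and> w \<in> V \<and> disjnt U V"
      using openin_ext by blast
  qed
  fix D u w assume D: "connectedin (world_space G) D" "u \<in> D" "w \<in> D"
  have sub: "D \<subseteq> worlds G" using connectedin_subset_topspace[OF D(1)] by (simp add: topspace_world_space)
  show "u = w"
  proof (rule ccontr)
    assume "u \<noteq> w"
    then obtain p where p: "u \<in> ext G p" "w \<in> ext G (p \<^bold>\<rightarrow> Bot)"
      using worlds_separated D sub by (metis subsetD)
    have "D \<subseteq> ext G p \<union> ext G (p \<^bold>\<rightarrow> Bot)" "ext G p \<inter> ext G (p \<^bold>\<rightarrow> Bot) \<inter> D = {}"
      using sub by (auto simp: ext_Impl ext_Bot)
    moreover have "ext G p \<inter> D \<noteq> {}" "ext G (p \<^bold>\<rightarrow> Bot) \<inter> D \<noteq> {}" using D p by auto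
    ultimately show False using D(1) openin_ext unfolding connectedin by metis
  qed
qed

text \<open>A clopen set is compact and a union of extensions, hence a finite union of them, which a
  disjunction names.\<close>

lemma clopenin_world_spaceE:
  assumes "clopenin (world_space G) A"
  obtains p where "A = ext G p"
proof -
  have "compactin (world_space G) A"
    using assms closedin_compact_space compact_world_space unfolding clopenin_def by blast
  moreover have "A \<subseteq> \<Union>(ext G ` {p. ext G p \<subseteq> A})"
    using assms unfolding clopenin_def openin_world_space by (fastforce simp: ext_def)
  ultimately obtain \<F> where F: "finite \<F>" "\<F> \<subseteq> ext G ` {p. ext G p \<subseteq> A}" "A \<subseteq> \<Union>\<F>"
    using openin_ext unfolding compactin_def by (metis (no_types, lifting) imageE)
  have "\<exists>p. \<Union>\<F> = ext G p" if "finite \<F>" "\<F> \<subseteq> range (ext G)" for \<F>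
    using that
  proof (induction \<F>)
    case empty
    then show ?case using ext_Bot by (metis Union_empty)
  next
    case (insert U \<F>)
    then obtain p q where "U = ext G p" "\<Union>\<F> = ext G q" by auto
    then have "\<Union>(insert U \<F>) = ext G (p \<^bold>\<or> q)" by (simp add: ext_Disj)
    then show ?case by blast
  qed
  then obtain p where "\<Union>\<F> = ext G p" using F by (meson image_mono order_trans subset_UNIV)
  moreover have "\<Union>\<F> = A" using F by blast
  ultimately show ?thesis using that by blast
qed

section \<open>The canonical model\<close>

definition consequents :: "'v fm set \<Rightarrow> 'v fm \<Rightarrow> 'v fm set" where
  "consequents w p = {q. p \<box>\<rightarrow> q \<in> w}"

definition near :: "'v fm set \<Rightarrow> 'v fm set \<Rightarrow> 'v fm \<Rightarrow> 'v fm set set" where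
  "near G w p = {u \<in> worlds G. consequents w p \<subseteq> u}"

text \<open>Selection must act on sets, whereas \<open>near\<close> acts on formulas. The union
  avoids choosing a formula for \<open>A\<close>; by \<open>select_ext\<close> all its members
  coincide.\<close>

definition select :: "'v fm set \<Rightarrow> 'v fm set \<Rightarrow> 'v fm set set \<Rightarrow> 'v fm set set" where
  "select G w A = \<Union>(near G w ` {p. ext G p = A})"

lemma world_Lw: "w \<in> worlds G \<Longrightarrow> p \<in> lewis_axioms \<Longrightarrow> p \<in> w"
  using theory_GV[OF world_theory GV.Lw] .

text \<open>The inclusion means that the implication is derivable from \<open>G\<close>, so rule
  \<open>C\<close> applies and its conclusion lies in every world.\<close>

lemma world_Cf_mono:
  assumes "w \<in> worlds G" "ext G q \<subseteq> ext G r" "p \<box>\<rightarrow> q \<in> w"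
  shows "p \<box>\<rightarrow> r \<in> w"
  using assms GV.C[of G q r p] by (auto simp: GV_Impl_iff ext_def)

lemma world_Cf_Conj:
  assumes "w \<in> worlds G"
  shows "p \<box>\<rightarrow> q \<^bold>\<and> r \<in> w \<longleftrightarrow> p \<box>\<rightarrow> q \<in> w \<and> p \<box>\<rightarrow> r \<in> w"
  using world_Lw[OF assms lewis_axioms.L4[of p q r]]
  unfolding world_Conj[OF assms] world_Impl[OF assms] by blast

text \<open>L1 and rule \<open>C\<close> supply the formulas derivable from \<open>G\<close>; L4
  joins the two premises of modus ponens into one consequent.\<close>

lemma theory_consequents:
  assumes w: "w \<in> worlds G"
  shows "theory_over G (consequents w p)"
  unfolding theory_over_def consequents_def
proof (intro conjI allI impI subsetI; clarsimp)
  have "p \<box>\<rightarrow> p \<in> w" using world_Lw[OF w lewis_axioms.L1] .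
  then show "p \<box>\<rightarrow> q \<in> w" if "G \<turnstile>\<^sub>G\<^sub>V q" for q
    using world_Cf_mono[OF w, of p q] that by (auto simp: GV_iff_worlds ext_def)
  show "p \<box>\<rightarrow> r \<in> w" if "p \<box>\<rightarrow> (q \<^bold>\<rightarrow> r) \<in> w" "p \<box>\<rightarrow> q \<in> w" for q r
  proof (rule world_Cf_mono[OF w])
    show "p \<box>\<rightarrow> ((q \<^bold>\<rightarrow> r) \<^bold>\<and> q) \<in> w" using that world_Cf_Conj[OF w] by blast
    show "ext G ((q \<^bold>\<rightarrow> r) \<^bold>\<and> q) \<subseteq> ext G r" by (auto simp: ext_Conj ext_Impl)
  qed
qed

text \<open>If \<open>q\<close> is not a consequent of \<open>p\<close>, \<open>lindenbaum\<close>
  extends the theory of consequents to a nearby world that omits \<open>q\<close>.\<close>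

lemma near_subset_iff:
  assumes "w \<in> worlds G"
  shows "near G w p \<subseteq> ext G q \<longleftrightarrow> p \<box>\<rightarrow> q \<in> w"
  using lindenbaum[OF theory_consequents[OF assms, of p], of q]
  unfolding near_def ext_def consequents_def by blast

lemma near_cong:
  assumes w: "w \<in> worlds G" and "near G w p \<subseteq> ext G q" "near G w q \<subseteq> ext G p"
  shows "near G w p = near G w q"
proof -
  have "p \<box>\<rightarrow> r \<in> w \<longleftrightarrow> q \<box>\<rightarrow> r \<in> w" for r
    using world_Lw[OF w lewis_axioms.L2[of p q r]] assms(2,3)
    unfolding near_subset_iff[OF w] world_Conj[OF w] world_Impl[OF w] by blast
  then show ?thesis by (simp add: near_def consequents_def)
qed

lemma near_subset: "w \<in> worlds G \<Longrightarrow> near G w p \<subseteq> ext G p"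
  using near_subset_iff world_Lw lewis_axioms.L1 by blast

lemma near_Disj:
  assumes w: "w \<in> worlds G"
  shows "near G w (p \<^bold>\<or> q) \<subseteq> ext G p \<or> near G w (p \<^bold>\<or> q) \<subseteq> ext G q \<or>
    near G w (p \<^bold>\<or> q) = near G w p \<union> near G w q"
proof -
  have "near G w (p \<^bold>\<or> q) = near G w p \<union> near G w q"
    if "\<not> near G w (p \<^bold>\<or> q) \<subseteq> ext G p" "\<not> near G w (p \<^bold>\<or> q) \<subseteq> ext G q"
  proof -
    have iff: "(p \<^bold>\<or> q) \<box>\<rightarrow> r \<in> w \<longleftrightarrow> p \<box>\<rightarrow> r \<in> w \<and> q \<box>\<rightarrow> r \<in> w" for r
      using world_Lw[OF w lewis_axioms.L3[of p q r]] that
      unfolding near_subset_iff[OF w] world_Disj[OF w] world_Conj[OF w] world_Impl[OF w] by blast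
    have "u \<in> near G w p \<union> near G w q" if u: "u \<in> near G w (p \<^bold>\<or> q)" for u
    proof (rule ccontr)
      assume "u \<notin> near G w p \<union> near G w q"
      \<comment> \<open>One consequent of each disjunct fails at \<open>u\<close>. Their disjunction
        is a consequent of both \<open>p\<close> and \<open>q\<close>, hence by \<open>iff\<close>
        of the disjunction of \<open>p\<close> and \<open>q\<close>, and must hold at
        \<open>u\<close>.\<close>
      then obtain r s where rs: "p \<box>\<rightarrow> r \<in> w" "q \<box>\<rightarrow> s \<in> w" "r \<notin> u" "s \<notin> u"
        using u unfolding near_def consequents_def by blast
      then have "p \<box>\<rightarrow> (r \<^bold>\<or> s) \<in> w" "q \<box>\<rightarrow> (r \<^bold>\<or> s) \<in> w"
        using world_Cf_mono[OF w, of r "r \<^bold>\<or> s"] world_Cf_mono[OF w, of s "r \<^bold>\<or> s"]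
        by (simp_all add: ext_Disj)
      then have "u \<in> ext G (r \<^bold>\<or> s)" using iff u near_subset_iff[OF w] by blast
      then show False using rs by (auto simp: ext_Disj) (auto simp: ext_def)
    qed
    then show ?thesis using iff unfolding near_def consequents_def by blast
  qed
  then show ?thesis by blast
qed

lemma select_ext:
  assumes w: "w \<in> worlds G"
  shows "select G w (ext G p) = near G w p"
proof -
  have "near G w q = near G w p" if "ext G q = ext G p" for q
    using near_cong[OF w, of q p] near_subset[OF w, of p] near_subset[OF w, of q] that by blast
  then show ?thesis unfolding select_def by blast
qed

lemma selection_select:
  assumes w: "w \<in> worlds G"
  shows "selection (range (ext G)) (select G w)"
proof
  fix A B assume "A \<in> range (ext G)" "B \<in> range (ext G)"
  then obtain p q where pq: "A = ext G p" "B = ext G q" by blast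
  show "A \<union> B \<in> range (ext G)" unfolding pq ext_Disj[symmetric] by blast
  have "A - B = ext G (p \<^bold>\<and> (q \<^bold>\<rightarrow> Bot))"
    unfolding pq ext_Conj ext_Impl ext_Bot by (auto simp: ext_def)
  then show "A - B \<in> range (ext G)" by blast
  show "select G w A \<subseteq> A" unfolding pq select_ext[OF w] by (rule near_subset[OF w])
  show "select G w A = select G w B" if "select G w A \<subseteq> B" "select G w B \<subseteq> A"
    using that near_cong[OF w] unfolding pq select_ext[OF w] by blast
  show "select G w (A \<union> B) \<subseteq> A \<or> select G w (A \<union> B) \<subseteq> B \<or>
      select G w (A \<union> B) = select G w A \<union> select G w B"
    using near_Disj[OF w] unfolding pq ext_Disj[symmetric] select_ext[OF w] .
qed

section \<open>Spheres of the canonical model\<close>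

definition canonical_spheres :: "'v fm set \<Rightarrow> 'v fm set \<Rightarrow> 'v fm set set set" where
  "canonical_spheres G w = selection.spheres (range (ext G)) (select G w)"

lemma closest_canonical:
  assumes "w \<in> worlds G"
  shows "closest (canonical_spheres G) (ext G p) w = near G w p"
proof -
  interpret selection "range (ext G)" "select G w" using selection_select[OF assms] .
  show ?thesis
    using closest_spheres[of "canonical_spheres G" w] select_ext[OF assms]
    by (simp add: canonical_spheres_def)
qed

lemma canonical_limit:
  assumes "w \<in> worlds G" and "ext G p \<inter> \<Union>(canonical_spheres G w) \<noteq> {}"
  shows "\<exists>U\<in>canonical_spheres G w. U \<inter> ext G p \<noteq> {} \<and>
    (\<forall>V\<in>canonical_spheres G w. V \<inter> ext G p \<noteq> {} \<longrightarrow> U \<subseteq> V)"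
proof -
  interpret selection "range (ext G)" "select G w" using selection_select[OF assms(1)] .
  obtain V where "V \<in> spheres" "V \<inter> ext G p \<noteq> {}"
    using assms(2) unfolding canonical_spheres_def by blast
  then show ?thesis
    unfolding canonical_spheres_def
    by (intro bexI[of _ "sphere (ext G p)"]) (simp_all add: sphere_least)
qed

lemma closedin_near: "closedin (world_space G) (near G w p)"
proof -
  \<comment> \<open>\<open>Top\<close> keeps the intersection inside \<open>worlds G\<close> even if
    there are no consequents; \<open>w\<close> is not assumed to be a world.\<close>
  have eq: "near G w p = \<Inter>(ext G ` insert Top (consequents w p))"
    by (auto simp: near_def ext_Top) (auto simp: ext_def)
  have "closedin (world_space G) (ext G q)" for q
    using clopenin_ext unfolding clopenin_def by blast
  then show ?thesis unfolding eq by (intro closedin_Inter) blast+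
qed

lemma canonical_topological_sphere: "topological_sphere (world_space G) (canonical_spheres G)"
  unfolding topological_sphere_def topspace_world_space
proof (intro conjI ballI allI impI)
  show "Stone_space (world_space G)" by (rule Stone_world_space)
next
  fix w U assume w: "w \<in> worlds G" and "U \<in> canonical_spheres G w"
  interpret selection "range (ext G)" "select G w" using selection_select[OF w] .
  show "U \<subseteq> worlds G"
    using Union_spheres_subset \<open>U \<in> _\<close> unfolding canonical_spheres_def ext_def by blast
next
  fix w assume w: "w \<in> worlds G"
  interpret selection "range (ext G)" "select G w" using selection_select[OF w] .
  show "chain\<^sub>\<subseteq> (canonical_spheres G w)"
    using chain_spheres unfolding canonical_spheres_def .
next
  fix A B assume "clopenin (world_space G) A" "clopenin (world_space G) B"
  then obtain p q where pq: "A = ext G p" "B = ext G q" by (metis clopenin_world_spaceE)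
  \<comment> \<open>The set required to be clopen is itself the extension of a
    counterfactual.\<close>
  have "{w \<in> worlds G. closest (canonical_spheres G) A w \<subseteq> B} = ext G (p \<box>\<rightarrow> q)"
    by (simp add: pq closest_canonical near_subset_iff ext_def[of G "p \<box>\<rightarrow> q"] cong: conj_cong)
  then show "clopenin (world_space G) {w \<in> worlds G. closest (canonical_spheres G) A w \<subseteq> B}"
    by (simp add: clopenin_ext)
next
  fix A w assume "clopenin (world_space G) A" and w: "w \<in> worlds G"
  then obtain p where p: "A = ext G p" by (metis clopenin_world_spaceE)
  show "closedin (world_space G) (closest (canonical_spheres G) A w)"
    unfolding p closest_canonical[OF w] by (rule closedin_near)
  assume "A \<inter> \<Union>(canonical_spheres G w) \<noteq> {}"
  then show "\<exists>U\<in>canonical_spheres G w. U \<inter> A \<noteq> {} \<and>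
      (\<forall>V\<in>canonical_spheres G w. V \<inter> A \<noteq> {} \<longrightarrow> U \<subseteq> V)"
    unfolding p by (rule canonical_limit[OF w])
qed

section \<open>Truth lemma and completeness\<close>

lemma truth_canonical:
  "truth (worlds G) (canonical_spheres G) (\<lambda>a. ext G (Var a)) p = ext G p"
proof (induction p)
  case (Cf p q)
  have "cf_holds (canonical_spheres G w) (ext G p) (ext G q) \<longleftrightarrow> p \<box>\<rightarrow> q \<in> w"
    if w: "w \<in> worlds G" for w
    using cf_holds_closest[of "ext G p" "canonical_spheres G" w] canonical_limit[OF w]
    by (simp add: closest_canonical[OF w] near_subset_iff[OF w])
  then show ?case
    by (auto simp: set_eq_iff mem_truth_Cf Cf ext_def[of G "p \<box>\<rightarrow> q"] simp del: truth.simps(7))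
qed (auto simp: ext_Impl ext_Conj ext_Disj ext_Bot ext_Top)

lemma GV_complete_LTS:
  fixes G :: "'v fm set"
  assumes "G \<Turnstile>\<^sub>L\<^sub>T\<^sub>S[TYPE('v fm set)] p"
  shows "G \<turnstile>\<^sub>G\<^sub>V p"
proof -
  have "(worlds G, canonical_spheres G, \<lambda>a. ext G (Var a)) \<in> LTS"
    unfolding LTS_def using canonical_topological_sphere clopenin_ext
    by (force simp: topspace_world_space[symmetric])
  moreover have "w \<in> ext G q" if "w \<in> worlds G" "q \<in> G" for w q
    using GV.Asm[OF that(2)] that(1) by (auto simp: GV_iff_worlds ext_def)
  ultimately have "\<forall>w\<in>worlds G. w \<in> ext G p"
    using assms unfolding LTS_conseq_def by (fastforce simp: truth_canonical)
  then show ?thesis by (simp add: GV_iff_worlds ext_def)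
qed

text \<open>Soundness holds for every type of worlds, and the canonical worlds live in
  \<open>'v fm set\<close>; hence consequence at that type already implies consequence at every
  type.\<close>

theorem theorem5p33:
  fixes \<Gamma> :: "'v fm set" and \<phi> :: "'v fm"
  shows "(\<Gamma> \<turnstile>\<^sub>G\<^sub>V \<phi> \<longleftrightarrow> \<Gamma> \<Turnstile>\<^sub>L\<^sub>T\<^sub>S[TYPE('v fm set)] \<phi>) \<and>
         (\<Gamma> \<turnstile>\<^sub>G\<^sub>V \<phi> \<longrightarrow> \<Gamma> \<Turnstile>\<^sub>L\<^sub>T\<^sub>S[TYPE('w)] \<phi>)"
  by (intro conjI iffI impI; rule GV_sound_LTS GV_complete_LTS; assumption)

end
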